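(* Let $d\ge 2$ and let $F_1,\dots,F_d$ be distribution functions that are symmetric with zero means. Let $U\sim U[0,1]$, and let $G_i$ denote the distribution function of $|X_i|$ when $X_i\sim F_i$. There exists a random vector $(X_1,\dots,X_d)$ with $X_i\sim F_i$ for all $i$ such that $|X_1|,\dots,|X_d|$ are comonotonic and $\prod_{i=1}^d X_i\le 0$ a.s. Hence $$m=-\mathbb{E}\left(\prod_{i=1}^d G_i^{-1}(U)\right),$$ and $m$ is attained by this vector. Furthermore, such a vector is given by $X_i=F_i^{-1}(U_i)$, $i=1,\dots,d$, where the $U_i$ are as follows. If $d$ is odd, $$\begin{aligned}U_1&=U_2=\cdots=U_{d-2}=U,\\ U_{d-1}&=IJU+I(1-J)(1-U)+(1-I)JU+(1-I)(1-J)(1-U),\\ U_d&=IJ(1-U)+I(1-J)U+(1-I)JU+(1-I)(1-J)(1-U),\end{aligned}$$ where $I=\mathbf{1}_{U>1/2}$, $J=\mathbf{1}_{V>1/2}$, and $V\sim U[0,1]$ is independent of $U$. If $d$ is even, $U_1=U_2=\cdots=U_{d-1}=U$ and $U_d=1-U$.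
   Context: All random variables $X_i\sim F_i$ are square integrable. $X\sim F$ means that $X$ has distribution function $F$, and $F^{-1}$ is the (generalized, left-continuous) inverse, i.e. the quantile function, of $F$. A distribution function with zero mean is symmetric if $X\sim F$ implies $-X\sim F$. Define $m=\inf \mathbb{E}(X_1X_2\cdots X_d)$, where the infimum is over all random vectors $(X_1,\dots,X_d)$ with $X_i\sim F_i$ for all $i$ and arbitrary dependence, for which the expectation is well defined (in $[-\infty,\infty]$). A vector with $X_i\sim F_i$ for all $i$ attains $m$ if $\mathbb{E}(X_1\cdots X_d)=m$. Random variables $Y_1,\dots,Y_d$ are comonotonic if $(Y_1,\dots,Y_d)$ has the same law as $(H_1^{-1}(W),\dots,H_d^{-1}(W))$, where $Y_i\sim H_i$ and $W\sim U[0,1]$. *)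

theory Defs
  imports "HOL-Probability.Probability"
begin

definition is_df :: "(real \<Rightarrow> real) \<Rightarrow> bool" where
  "is_df F \<longleftrightarrow> mono F \<and> (\<forall>x. continuous (at_right x) F) \<and>
     (F \<longlongrightarrow> 0) at_bot \<and> (F \<longlongrightarrow> 1) at_top"

text \<open>\<open>X \<sim> F\<close>, for a random variable \<open>X\<close> on the probability space \<open>M\<close>.\<close>

definition has_df :: "'w measure \<Rightarrow> ('w \<Rightarrow> real) \<Rightarrow> (real \<Rightarrow> real) \<Rightarrow> bool" where
  "has_df M X F \<longleftrightarrow> X \<in> borel_measurable M \<and> cdf (distr M borel X) = F"

text \<open>For a distribution function \<open>F\<close>, \<open>interval_measure F\<close> is the law of every \<open>X \<sim> F\<close>
  (lemma \<open>has_df_law\<close> below), so moments of \<open>X\<close> are integrals against it.\<close>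

definition square_integrable_df :: "(real \<Rightarrow> real) \<Rightarrow> bool" where
  "square_integrable_df F \<longleftrightarrow> integrable (interval_measure F) (\<lambda>x. x\<^sup>2)"

definition zero_mean_df :: "(real \<Rightarrow> real) \<Rightarrow> bool" where
  "zero_mean_df F \<longleftrightarrow> has_bochner_integral (interval_measure F) (\<lambda>x. x) 0"

text \<open>Real sample spaces suffice: whether \<open>- X \<sim> F\<close> depends only on the law of \<open>X\<close>
  (lemma \<open>symmetric_dfD\<close>).\<close>

definition symmetric_df :: "(real \<Rightarrow> real) \<Rightarrow> bool" where
  "symmetric_df F \<longleftrightarrow>
     (\<forall>(M :: real measure) X. prob_space M \<longrightarrow> has_df M X F \<longrightarrow> has_df M (\<lambda>\<omega>. - X \<omega>) F)"

text \<open>The distribution function of \<open>\<bar>X\<bar>\<close> when \<open>X \<sim> F\<close>.\<close>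

definition abs_df :: "(real \<Rightarrow> real) \<Rightarrow> real \<Rightarrow> real" where
  "abs_df F = cdf (distr (interval_measure F) borel (\<lambda>x. \<bar>x\<bar>))"

text \<open>The left-continuous inverse. It is meaningful for \<open>0 < u < 1\<close>; at the endpoints, where the
  true value may be infinite, it takes some real value, which is irrelevant below because
  these points are hit with probability zero by a uniform random variable.\<close>

definition quantile :: "(real \<Rightarrow> real) \<Rightarrow> real \<Rightarrow> real" where
  "quantile F u = Inf {x. u \<le> F x}"

definition uniform01 :: "'w measure \<Rightarrow> ('w \<Rightarrow> real) \<Rightarrow> bool" where
  "uniform01 M U \<longleftrightarrow>
     U \<in> borel_measurable M \<and> distr M borel U = uniform_measure lborel {0..1}"

definition comonotonic :: "'w measure \<Rightarrow> nat \<Rightarrow> (nat \<Rightarrow> 'w \<Rightarrow> real) \<Rightarrow> bool" where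
  "comonotonic M d Y \<longleftrightarrow>
     (\<forall>i\<in>{1..d}. (Y i) \<in> borel_measurable M) \<and>
     distr M (\<Pi>\<^sub>M i\<in>{1..d}. borel) (\<lambda>\<omega>. \<lambda>i\<in>{1..d}. Y i \<omega>) =
     distr (uniform_measure lborel {0..1}) (\<Pi>\<^sub>M i\<in>{1..d}. borel)
       (\<lambda>w. \<lambda>i\<in>{1..d}. quantile (cdf (distr M borel (Y i))) w)"

text \<open>Expectation with values in \<open>[-\<infinity>,\<infinity>]\<close>, and when it is well defined.\<close>

definition expectation_defined :: "'w measure \<Rightarrow> ('w \<Rightarrow> real) \<Rightarrow> bool" where
  "expectation_defined M Z \<longleftrightarrow> Z \<in> borel_measurable M \<and>
     ((\<integral>\<^sup>+\<omega>. ennreal (Z \<omega>) \<partial>M) < \<infinity> \<or> (\<integral>\<^sup>+\<omega>. ennreal (- Z \<omega>) \<partial>M) < \<infinity>)"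

definition ext_expectation :: "'w measure \<Rightarrow> ('w \<Rightarrow> real) \<Rightarrow> ereal" where
  "ext_expectation M Z =
     enn2ereal (\<integral>\<^sup>+\<omega>. ennreal (Z \<omega>) \<partial>M) - enn2ereal (\<integral>\<^sup>+\<omega>. ennreal (- Z \<omega>) \<partial>M)"

definition random_vector ::
  "'w measure \<Rightarrow> nat \<Rightarrow> (nat \<Rightarrow> real \<Rightarrow> real) \<Rightarrow> (nat \<Rightarrow> 'w \<Rightarrow> real) \<Rightarrow> bool" where
  "random_vector M d F X \<longleftrightarrow> prob_space M \<and> (\<forall>i\<in>{1..d}. has_df M (X i) (F i))"

text \<open>The infimum \<open>m\<close>. Sample spaces over \<^typ>\<open>nat \<Rightarrow> real\<close> suffice, since every
  random vector can be transported there by passing to its joint law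
  (lemma \<open>inf_expected_product_le\<close>).\<close>

definition inf_expected_product :: "nat \<Rightarrow> (nat \<Rightarrow> real \<Rightarrow> real) \<Rightarrow> ereal" where
  "inf_expected_product d F = Inf {ext_expectation M (\<lambda>\<omega>. \<Prod>i=1..d. X i \<omega>) |
     (M :: (nat \<Rightarrow> real) measure) X.
     random_vector M d F X \<and> expectation_defined M (\<lambda>\<omega>. \<Prod>i=1..d. X i \<omega>)}"

definition attains_inf ::
  "'w measure \<Rightarrow> nat \<Rightarrow> (nat \<Rightarrow> real \<Rightarrow> real) \<Rightarrow> (nat \<Rightarrow> 'w \<Rightarrow> real) \<Rightarrow> bool" where
  "attains_inf M d F X \<longleftrightarrow> expectation_defined M (\<lambda>\<omega>. \<Prod>i=1..d. X i \<omega>) \<and>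
     ext_expectation M (\<lambda>\<omega>. \<Prod>i=1..d. X i \<omega>) = inf_expected_product d F"

definition odd_uniforms ::
  "nat \<Rightarrow> ('w \<Rightarrow> real) \<Rightarrow> ('w \<Rightarrow> real) \<Rightarrow> nat \<Rightarrow> 'w \<Rightarrow> real" where
  "odd_uniforms d U V i \<omega> =
     (let u = U \<omega>; I = of_bool (U \<omega> > 1/2); J = of_bool (V \<omega> > 1/2) in
      if i = d then
        I * J * (1 - u) + I * (1 - J) * u + (1 - I) * J * u + (1 - I) * (1 - J) * (1 - u)
      else if i = d - 1 then
        I * J * u + I * (1 - J) * (1 - u) + (1 - I) * J * u + (1 - I) * (1 - J) * (1 - u)
      else u)"

definition even_uniforms :: "nat \<Rightarrow> ('w \<Rightarrow> real) \<Rightarrow> nat \<Rightarrow> 'w \<Rightarrow> real" where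
  "even_uniforms d U i \<omega> = (if i = d then 1 - U \<omega> else U \<omega>)"

lemma is_df_real_distribution:
  assumes "is_df F"
  shows "real_distribution (interval_measure F)" and "cdf (interval_measure F) = F"
  using assms unfolding is_df_def mono_def
  by (auto intro!: real_distribution_interval_measure cdf_interval_measure)

lemma has_df_law:
  assumes "prob_space M" "has_df M X F" "is_df F"
  shows "distr M borel X = interval_measure F"
proof (rule cdf_unique)
  show "real_distribution (distr M borel X)"
    using assms(1,2) by (auto simp: has_df_def intro!: prob_space.real_distribution_distr)
  show "cdf (distr M borel X) = cdf (interval_measure F)"
    using assms(2) is_df_real_distribution(2)[OF assms(3)] by (simp add: has_df_def)
qed (rule is_df_real_distribution(1)[OF assms(3)])

lemma symmetric_dfD:
  assumes "symmetric_df F" "prob_space M" "has_df M X F"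
  shows "has_df M (\<lambda>\<omega>. - X \<omega>) F"
proof -
  have X: "X \<in> borel_measurable M" using assms(3) by (simp add: has_df_def)
  let ?N = "distr M borel X"
  have "prob_space ?N" using assms(2) X by (rule prob_space.prob_space_distr)
  moreover have "has_df ?N (\<lambda>x. x) F"
    using assms(3) X by (simp add: has_df_def distr_distr comp_def)
  ultimately have "has_df ?N (\<lambda>x. - x) F"
    using assms(1) unfolding symmetric_df_def by blast
  then show ?thesis using X by (simp add: has_df_def distr_distr comp_def)
qed

lemma inf_expected_product_le:
  assumes "random_vector M d F X" "expectation_defined M (\<lambda>\<omega>. \<Prod>i=1..d. X i \<omega>)"
  shows "inf_expected_product d F \<le> ext_expectation M (\<lambda>\<omega>. \<Prod>i=1..d. X i \<omega>)"
proof -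
  let ?P = "\<Pi>\<^sub>M i\<in>{1..d}. (borel :: real measure)"
  let ?T = "\<lambda>\<omega>. \<lambda>i\<in>{1..d}. X i \<omega>"
  let ?N = "distr M ?P ?T"
  let ?p = "\<lambda>x :: nat \<Rightarrow> real. \<Prod>i=1..d. x i"
  interpret prob_space M using assms(1) by (simp add: random_vector_def)
  have X: "X i \<in> borel_measurable M" if "i \<in> {1..d}" for i
    using assms(1) that by (auto simp: random_vector_def has_df_def)
  have T[measurable]: "?T \<in> measurable M ?P"
    by (rule measurable_restrict) (use X in auto)
  have C: "(\<lambda>x. x i) \<in> borel_measurable ?P" if "i \<in> {1..d}" for i
    using that by (rule measurable_component_singleton)
  have p[measurable]: "?p \<in> borel_measurable ?P"
    by (intro borel_measurable_prod C)
  have D: "distr ?N borel (\<lambda>x. x i) = distr M borel (X i)" if "i \<in> {1..d}" for i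
    unfolding distr_distr[OF C[OF that] T] comp_def using that by simp
  have V: "random_vector ?N d F (\<lambda>i x. x i)"
    using assms(1) C D prob_space_distr[OF T]
    by (auto simp: random_vector_def has_df_def)
  have pT: "?p (?T \<omega>) = (\<Prod>i=1..d. X i \<omega>)" for \<omega>
    by (rule prod.cong) auto
  have pos: "(\<integral>\<^sup>+x. ennreal (?p x) \<partial>?N) = (\<integral>\<^sup>+\<omega>. ennreal (\<Prod>i=1..d. X i \<omega>) \<partial>M)"
    by (subst nn_integral_distr) (simp_all only: pT, measurable)
  have neg: "(\<integral>\<^sup>+x. ennreal (- ?p x) \<partial>?N) = (\<integral>\<^sup>+\<omega>. ennreal (- (\<Prod>i=1..d. X i \<omega>)) \<partial>M)"
    by (subst nn_integral_distr) (simp_all only: pT, measurable)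
  have "expectation_defined ?N ?p"
    using assms(2) p unfolding expectation_defined_def pos neg by simp
  moreover have "ext_expectation ?N ?p = ext_expectation M (\<lambda>\<omega>. \<Prod>i=1..d. X i \<omega>)"
    unfolding ext_expectation_def pos neg ..
  ultimately show ?thesis
    unfolding inf_expected_product_def
    by (intro Inf_lower CollectI exI[of _ ?N] exI[of _ "\<lambda>i x. x i"]) (use V in auto)
qed

end

theory Submission
  imports Defs
begin

text \<open>For a symmetric \<open>F\<close> one has \<open>\<bar>quantile F u\<bar> = quantile (abs_df F) \<bar>2 * u - 1\<bar>\<close> for almost every \<open>u\<close>.
  So whenever the uniform variables \<open>T i\<close> are each equal to \<open>U\<close> or \<open>1 - U\<close>, pointwise, the absolute
  values \<open>\<bar>quantile (F i) (T i)\<bar>\<close> are the quantiles of one uniform variable \<open>\<bar>2 * U - 1\<bar>\<close>, hence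
  comonotonic, and the sign of the product is that of the product of the \<open>T i - 1/2\<close>.
  The product of such a coupling with negative sign has expectation minus the expected product
  of the comonotonic absolute values, and no coupling does better: a product is at least minus
  the product of its absolute values, and expected products of nonnegative variables are
  maximal under comonotonicity.\<close>

section \<open>The uniform law on the unit interval\<close>

abbreviation unif :: "real measure" where
  "unif \<equiv> uniform_measure lborel {0..1}"

lemma prob_space_unif: "prob_space unif"
  by (rule prob_space_uniform_measure) auto

lemma real_distribution_unif: "real_distribution unif"
  using prob_space_unif by (simp add: real_distribution_def real_distribution_axioms_def)

lemma AE_unif: "AE u in unif. 0 < u \<and> u < 1 \<and> u \<noteq> 1/2"
proof (rule AE_uniform_measureI)
  show "AE u in lborel. u \<in> {0..1} \<longrightarrow> 0 < u \<and> u < 1 \<and> u \<noteq> (1/2::real)"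
    using AE_lborel_singleton[of 0] AE_lborel_singleton[of 1] AE_lborel_singleton[of "1/2"]
    by eventually_elim auto
qed simp

lemma uniform01_measurable: "uniform01 M U \<Longrightarrow> U \<in> borel_measurable M"
  by (simp add: uniform01_def)

lemma uniform01_AE:
  assumes U: "uniform01 M U" and P: "AE u in unif. P u"
  shows "AE \<omega> in M. P (U \<omega>)"
proof -
  have "distr M borel U = unif" using U by (simp add: uniform01_def)
  then have "AE u in distr M borel U. P u" using P by (rule ssubst)
  then show ?thesis by (rule AE_distrD[OF uniform01_measurable[OF U]])
qed

lemma uniform01_compose:
  assumes U: "uniform01 M U" and f: "uniform01 unif f"
  shows "uniform01 M (\<lambda>\<omega>. f (U \<omega>))"
proof -
  have [measurable]: "U \<in> borel_measurable M" "f \<in> borel_measurable borel"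
    using U f by (auto simp: uniform01_def)
  have "distr M borel (\<lambda>\<omega>. f (U \<omega>)) = distr (distr M borel U) borel f"
    by (simp add: distr_distr comp_def)
  then show ?thesis using U f by (simp add: uniform01_def)
qed

lemma uniform01_unif_cdfI:
  assumes [measurable]: "f \<in> borel_measurable borel"
    and "\<And>x. measure lborel ({0..1} \<inter> {u. f u \<le> x}) = measure lborel ({0..1} \<inter> {..x})"
  shows "uniform01 unif f"
proof -
  have "distr unif borel f = unif"
  proof (rule cdf_unique)
    show "real_distribution (distr unif borel f)"
      by (rule prob_space.real_distribution_distr[OF prob_space_unif]) simp
    show "cdf (distr unif borel f) = cdf unif"
      using assms(2) by (auto simp: cdf_def measure_distr vimage_def)
  qed (rule real_distribution_unif)
  then show ?thesis by (simp add: uniform01_def)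
qed

lemma measure_unit_interval_atMost:
  "measure lborel ({0..1} \<inter> {..x}) = max 0 (min 1 (x::real))"
proof -
  have "{0..1} \<inter> {..x} = {0..min 1 x}" by auto
  then show ?thesis by simp
qed

lemma uniform01_reflect: "uniform01 unif (\<lambda>u. 1 - u)"
proof (rule uniform01_unif_cdfI)
  fix x :: real
  have "{0..1} \<inter> {u. 1 - u \<le> x} = {max 0 (1 - x)..1}" by auto
  then show "measure lborel ({0..1} \<inter> {u. 1 - u \<le> x}) = measure lborel ({0..1} \<inter> {..x})"
    by (auto simp: measure_unit_interval_atMost max_def min_def)
qed simp

text \<open>The map folds the interval at 1/2 and stretches each half by 2, so the preimage of an
  interval keeps its length. It identifies \<open>u\<close> with \<open>1 - u\<close>, which is why
  it serves as the common source of the absolute values.\<close>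

lemma uniform01_fold: "uniform01 unif (\<lambda>u. \<bar>2 * u - 1\<bar>)"
proof (rule uniform01_unif_cdfI)
  fix x :: real
  have "{0..1} \<inter> {u. \<bar>2 * u - 1\<bar> \<le> x} = {max 0 ((1 - x) / 2)..min 1 ((1 + x) / 2)}"
    by (auto simp: abs_le_iff)
  then show "measure lborel ({0..1} \<inter> {u. \<bar>2 * u - 1\<bar> \<le> x}) = measure lborel ({0..1} \<inter> {..x})"
    by (auto simp: measure_unit_interval_atMost max_def min_def field_simps)
qed simp

section \<open>Distribution functions and the quantile transform\<close>

lemma is_df_cdf: "real_distribution N \<Longrightarrow> is_df (cdf N)"
  unfolding is_df_def
  by (auto intro!: monoI finite_borel_measure.cdf_nondecreasing real_distribution.cdf_lim_at_top_prob
     finite_borel_measure.cdf_is_right_cont finite_borel_measure.cdf_lim_at_bot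
     real_distribution.finite_borel_measure_M)

lemma is_df_bounds:
  assumes "is_df F"
  shows "0 \<le> F x" and "F x \<le> 1"
proof -
  interpret real_distribution "interval_measure F"
    by (rule is_df_real_distribution(1)[OF assms])
  show "0 \<le> F x" "F x \<le> 1"
    using cdf_nonneg[of x] cdf_bounded_prob[of x] by (simp_all add: is_df_real_distribution(2)[OF assms])
qed

text \<open>Right-continuity of \<open>F\<close> makes the infimum in \<open>quantile\<close>
  attained. At the endpoints this can fail, because the set under the infimum may be empty or
  unbounded below.\<close>

lemma quantile_le_iff:
  assumes F: "is_df F" and u: "0 < u" "u < 1"
  shows "quantile F u \<le> x \<longleftrightarrow> u \<le> F x"
proof -
  interpret cdf_distribution "interval_measure F"
    unfolding cdf_distribution_def by (rule is_df_real_distribution(1)[OF F])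
  show ?thesis
    using pseudoinverse[OF u, of x] by (simp add: quantile_def is_df_real_distribution(2)[OF F])
qed

lemma quantile_mono:
  assumes F: "is_df F" and u: "0 < u" "u \<le> v" "v < 1"
  shows "quantile F u \<le> quantile F v"
proof -
  have "v \<le> F (quantile F v)" using quantile_le_iff[OF F, of v "quantile F v"] u by simp
  then show ?thesis using quantile_le_iff[OF F, of u "quantile F v"] u by simp
qed

lemma borel_measurable_quantile:
  assumes F: "is_df F"
  shows "quantile F \<in> borel_measurable borel"
proof (rule borel_measurable_piecewise_mono)
  \<comment> \<open>Off the interval from 0 to 1, \<open>quantile F\<close> takes the constant
    default values \<open>Inf UNIV\<close> and \<open>Inf {}\<close>. The point 1 is a piece of its
    own, since its value need not fit the monotonicity on either side.\<close>
  let ?C = "{{..0}, {0<..<1}, {1}, {1<..}} :: real set set"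
  show "countable ?C" by simp
  show "\<Union> ?C = UNIV" by auto
  show "c \<in> sets borel" if "c \<in> ?C" for c using that by auto
  have "quantile F u = Inf UNIV" if "u \<le> 0" for u
    using is_df_bounds(1)[OF F] that order_trans by (auto simp: quantile_def intro!: arg_cong[of _ _ Inf])
  moreover have "quantile F u = Inf {}" if "u > 1" for u
  proof -
    have "\<not> u \<le> F x" for x using is_df_bounds(2)[OF F, of x] that by linarith
    then show ?thesis by (simp add: quantile_def)
  qed
  ultimately show "mono_on c (quantile F)" if "c \<in> ?C" for c
    using that quantile_mono[OF F] by (auto simp: mono_on_def)
qed

text \<open>Inverse transform sampling: up to the null set of endpoints,
  \<open>quantile_le_iff\<close> turns the event that the quantile is at most \<open>x\<close> into
  the event that the uniform variable is at most \<open>F x\<close>.\<close>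

lemma has_df_quantile:
  assumes F: "is_df F" and T: "uniform01 M T"
  shows "has_df M (\<lambda>\<omega>. quantile F (T \<omega>)) F"
proof -
  note [measurable] = borel_measurable_quantile[OF F] uniform01_measurable[OF T]
  have "cdf (distr M borel (\<lambda>\<omega>. quantile F (T \<omega>))) x = F x" for x
  proof -
    have "distr M borel (\<lambda>\<omega>. quantile F (T \<omega>)) = distr (distr M borel T) borel (quantile F)"
      by (simp add: distr_distr comp_def)
    also have "\<dots> = distr unif borel (quantile F)"
      using T by (simp add: uniform01_def)
    finally have eq: "distr M borel (\<lambda>\<omega>. quantile F (T \<omega>)) = distr unif borel (quantile F)" .
    have "cdf (distr M borel (\<lambda>\<omega>. quantile F (T \<omega>))) x = measure unif {u. quantile F u \<le> x}"
      unfolding eq by (simp add: cdf_def measure_distr vimage_def)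
    also have "\<dots> = measure unif {..F x}"
    proof (rule measure_eq_AE)
      show "AE u in unif. u \<in> {u. quantile F u \<le> x} \<longleftrightarrow> u \<in> {..F x}"
        using AE_unif by eventually_elim (simp add: quantile_le_iff[OF F])
    qed simp_all
    also have "\<dots> = F x"
      using is_df_bounds[OF F, of x] by (simp add: measure_unit_interval_atMost)
    finally show ?thesis .
  qed
  then show ?thesis by (auto simp: has_df_def)
qed

section \<open>Rearrangement inequality by the layer-cake formula\<close>

lemma nn_integral_layer:
  assumes "0 \<le> y"
  shows "(\<integral>\<^sup>+t. indicator {0..} t * indicator {..<y} t \<partial>lborel) = ennreal y"
proof -
  have "(\<integral>\<^sup>+t. indicator {0..} t * indicator {..<y} t \<partial>lborel) = (\<integral>\<^sup>+t. indicator {0..<y} t \<partial>lborel)"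
    by (intro nn_integral_cong) (auto split: split_indicator)
  also have "\<dots> = ennreal y" using \<open>0 \<le> y\<close> by simp
  finally show ?thesis .
qed

text \<open>The set \<open>A\<close> makes the induction work: by the layer-cake formula a new factor \<open>Y j\<close> replaces
  \<open>A\<close> by \<open>A \<inter> {Y j > t}\<close>, whose probability is at most both \<open>P(A)\<close> and \<open>1 - G t\<close>, where \<open>G\<close> is
  the distribution function of \<open>Y j\<close>, and integrating \<open>1{G t < u}\<close> over \<open>t \<ge> 0\<close> gives the
  quantile of \<open>G\<close> at \<open>u\<close>.\<close>

lemma rearrangement_on_set:
  fixes Y :: "'i \<Rightarrow> 'w \<Rightarrow> real"
  assumes M: "prob_space M" and "finite I"
    and "\<And>i. i \<in> I \<Longrightarrow> Y i \<in> borel_measurable M"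
    and "\<And>i \<omega>. i \<in> I \<Longrightarrow> 0 \<le> Y i \<omega>"
    and "A \<in> sets M"
  shows "(\<integral>\<^sup>+\<omega>. (\<Prod>i\<in>I. ennreal (Y i \<omega>)) * indicator A \<omega> \<partial>M) \<le>
    (\<integral>\<^sup>+u. (\<Prod>i\<in>I. ennreal (quantile (cdf (distr M borel (Y i))) u)) *
       indicator {1 - measure M A<..<1} u \<partial>lborel)"
  using assms(2-)
proof (induction I arbitrary: A rule: finite_induct)
  case empty
  interpret prob_space M by (rule M)
  show ?case using empty.prems by (simp add: emeasure_eq_measure)
next
  case (insert j I)
  interpret prob_space M by (rule M)
  interpret p1: pair_sigma_finite M "lborel :: real measure" ..
  let ?G = "cdf (distr M borel (Y j))"
  let ?P = "\<lambda>\<omega>. \<Prod>i\<in>I. ennreal (Y i \<omega>)"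
  let ?Q = "\<lambda>u. \<Prod>i\<in>I. ennreal (quantile (cdf (distr M borel (Y i))) u)"
  have Y[measurable]: "Y i \<in> borel_measurable M" if "i \<in> insert j I" for i
    using insert.prems that by blast
  have Yj[measurable]: "Y j \<in> borel_measurable M" by (rule Y) simp
  note [measurable] = insert.prems(3)
  have df: "is_df (cdf (distr M borel (Y i)))" if "i \<in> insert j I" for i
    by (rule is_df_cdf) (use that Y in auto)
  have G: "is_df ?G" by (rule df) simp
  have [measurable]: "?P \<in> borel_measurable M" "?Q \<in> borel_measurable borel"
    using Y borel_measurable_quantile[OF df] by measurable
  have [measurable]: "?G \<in> borel_measurable borel"
    using G by (intro borel_measurable_mono) (simp add: is_df_def)
  have [measurable]: "quantile ?G \<in> borel_measurable borel"
    by (rule borel_measurable_quantile[OF G])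
  have Gt: "?G t = 1 - prob {\<omega>\<in>space M. t < Y j \<omega>}" for t
  proof -
    have "?G t = prob {\<omega>\<in>space M. Y j \<omega> \<le> t}"
      by (simp add: cdf_def measure_distr vimage_def Collect_conj_eq Int_commute)
    also have "\<dots> = 1 - prob {\<omega>\<in>space M. \<not> Y j \<omega> \<le> t}"
      by (subst prob_neg) auto
    finally show ?thesis by (simp add: not_le)
  qed
  have Q0: "0 \<le> quantile ?G u" if "0 < u" "u < 1" for u
  proof (rule ccontr)
    assume "\<not> 0 \<le> quantile ?G u"
    then have "u \<le> ?G (quantile ?G u)" "quantile ?G u < 0"
      using quantile_le_iff[OF G that] by auto
    moreover have "{\<omega>\<in>space M. quantile ?G u < Y j \<omega>} = space M"
      using insert.prems(2)[of j] \<open>quantile ?G u < 0\<close> by (auto intro: less_le_trans)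
    ultimately show False using Gt[of "quantile ?G u"] that by (simp add: prob_space)
  qed
  let ?B = "\<lambda>t. A \<inter> {\<omega>\<in>space M. t < Y j \<omega>}"
  have B[measurable]: "?B t \<in> sets M" for t by measurable
  \<comment> \<open>Only the new factor \<open>Y j\<close> is sliced into layers. The indicator of
    \<open>{0..}\<close> stays a separate factor: it does not depend on the sample point and leaves
    the inner integral after the exchange.\<close>
  have "(\<integral>\<^sup>+\<omega>. (\<Prod>i\<in>insert j I. ennreal (Y i \<omega>)) * indicator A \<omega> \<partial>M)
      = (\<integral>\<^sup>+\<omega>. \<integral>\<^sup>+t. ?P \<omega> * indicator A \<omega> * (indicator {0..} t * indicator {..<Y j \<omega>} t) \<partial>lborel \<partial>M)"
  proof (rule nn_integral_cong)
    fix \<omega>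
    have "(\<integral>\<^sup>+t. ?P \<omega> * indicator A \<omega> * (indicator {0..} t * indicator {..<Y j \<omega>} t) \<partial>lborel)
      = ?P \<omega> * indicator A \<omega> * ennreal (Y j \<omega>)"
      by (subst nn_integral_cmult) (use insert.prems(2)[of j \<omega>] in \<open>auto simp: nn_integral_layer\<close>)
    then show "(\<Prod>i\<in>insert j I. ennreal (Y i \<omega>)) * indicator A \<omega>
      = (\<integral>\<^sup>+t. ?P \<omega> * indicator A \<omega> * (indicator {0..} t * indicator {..<Y j \<omega>} t) \<partial>lborel)"
      using insert.hyps by (simp add: mult_ac)
  qed
  also have "\<dots> = (\<integral>\<^sup>+t. \<integral>\<^sup>+\<omega>. ?P \<omega> * indicator A \<omega> * (indicator {0..} t * indicator {..<Y j \<omega>} t) \<partial>M \<partial>lborel)"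
    by (rule p1.Fubini'[symmetric]) (simp add: split_beta' lessThan_def indicator_def of_bool_def)
  also have "\<dots> = (\<integral>\<^sup>+t. indicator {0..} t * (\<integral>\<^sup>+\<omega>. ?P \<omega> * indicator (?B t) \<omega> \<partial>M) \<partial>lborel)"
    by (subst nn_integral_cmult[symmetric], measurable)
       (auto intro!: nn_integral_cong split: split_indicator)
  also have "\<dots> \<le> (\<integral>\<^sup>+t. indicator {0..} t *
      (\<integral>\<^sup>+u. ?Q u * indicator {1 - prob (?B t)<..<1} u \<partial>lborel) \<partial>lborel)"
    by (intro nn_integral_mono mult_left_mono insert.IH) (use insert.prems in auto)
  also have "\<dots> \<le> (\<integral>\<^sup>+t. \<integral>\<^sup>+u. ?Q u * indicator {1 - prob A<..<1} u *
      (indicator {0..} t * indicator {u. ?G t < u} u) \<partial>lborel \<partial>lborel)"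
  proof (rule nn_integral_mono)
    fix t
    \<comment> \<open>By these two bounds, \<open>1 - prob (?B t) < u\<close> forces both
      \<open>1 - prob A < u\<close> and \<open>?G t < u\<close>. The first restores the interval
      belonging to \<open>A\<close>, the second becomes the layer of the new quantile.\<close>
    have "prob (?B t) \<le> prob A" "prob (?B t) \<le> 1 - ?G t"
      unfolding Gt by (auto intro!: finite_measure_mono)
    then show "indicator {0..} t * (\<integral>\<^sup>+u. ?Q u * indicator {1 - prob (?B t)<..<1} u \<partial>lborel)
      \<le> (\<integral>\<^sup>+u. ?Q u * indicator {1 - prob A<..<1} u *
      (indicator {0..} t * indicator {u. ?G t < u} u) \<partial>lborel)"
      by (subst nn_integral_cmult[symmetric], measurable)
         (auto intro!: nn_integral_mono split: split_indicator)
  qed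
  also have "\<dots> = (\<integral>\<^sup>+u. \<integral>\<^sup>+t. ?Q u * indicator {1 - prob A<..<1} u *
      (indicator {0..} t * indicator {u. ?G t < u} u) \<partial>lborel \<partial>lborel)"
    by (rule lborel_pair.Fubini') (simp add: split_beta' indicator_def of_bool_def)
  also have "\<dots> = (\<integral>\<^sup>+u. (\<Prod>i\<in>insert j I. ennreal (quantile (cdf (distr M borel (Y i))) u)) *
       indicator {1 - prob A<..<1} u \<partial>lborel)"
  proof (rule nn_integral_cong)
    fix u
    show "(\<integral>\<^sup>+t. ?Q u * indicator {1 - prob A<..<1} u *
        (indicator {0..} t * indicator {u. ?G t < u} u) \<partial>lborel)
      = (\<Prod>i\<in>insert j I. ennreal (quantile (cdf (distr M borel (Y i))) u)) *
        indicator {1 - prob A<..<1} u"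
    proof (cases "u \<in> {1 - prob A<..<1}")
      case True
      then have "1 - prob A < u" "u < 1" by auto
      then have u: "0 < u" "u < 1" using prob_le_1[of A] by linarith+
      \<comment> \<open>Negating \<open>quantile_le_iff\<close> turns \<open>?G t < u\<close> into
        \<open>t < quantile ?G u\<close>, so the integral over \<open>t\<close> is again a
        layer-cake integral.\<close>
      have "indicator {u. ?G t < u} u = (indicator {..<quantile ?G u} t :: ennreal)" for t
        using quantile_le_iff[OF G u, of t] by (auto simp: indicator_def)
      then have "(\<integral>\<^sup>+t. ?Q u * indicator {1 - prob A<..<1} u *
          (indicator {0..} t * indicator {u. ?G t < u} u) \<partial>lborel)
        = ?Q u * indicator {1 - prob A<..<1} u * ennreal (quantile ?G u)"
        by (simp only:) (simp add: nn_integral_cmult nn_integral_layer[OF Q0[OF u]])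
      then show ?thesis
        using insert.hyps by (simp add: mult_ac)
    qed simp
  qed
  finally show ?case .
qed

lemma uniform01_unif_self: "uniform01 unif (\<lambda>u. u)"
  by (simp add: uniform01_def distr_id2)

section \<open>Quantiles of a symmetric distribution function\<close>

context
  fixes F assumes F: "is_df F" and sym: "symmetric_df F"
begin

interpretation real_distribution "interval_measure F"
  by (rule is_df_real_distribution(1)[OF F])

text \<open>At the level of laws the reflection can be applied to closed half-lines
  \<open>{x..}\<close>, whose mass depends on a left limit of \<open>F\<close>.\<close>

lemma symmetric_df_law: "distr (interval_measure F) borel uminus = interval_measure F"
proof -
  have "has_df (interval_measure F) (\<lambda>x. x) F"
    using is_df_real_distribution(2)[OF F] by (simp add: has_df_def distr_id2)
  then have "has_df (interval_measure F) uminus F"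
    using symmetric_dfD[OF sym prob_space_axioms] by simp
  then show ?thesis
    by (rule has_df_law[OF prob_space_axioms _ F])
qed

lemma symmetric_df_atMost: "prob {..x} = F x"
  using is_df_real_distribution(2)[OF F] by (simp add: cdf_def fun_eq_iff)

lemma symmetric_df_atLeast: "prob {x..} = F (- x)"
proof -
  have "F (- x) = measure (distr (interval_measure F) borel uminus) {..- x}"
    by (simp only: symmetric_df_law symmetric_df_atMost)
  also have "\<dots> = prob {x..}"
    by (subst measure_distr) (auto simp: vimage_def intro!: arg_cong[where f = prob])
  finally show ?thesis by simp
qed

text \<open>The two closed half-lines at \<open>x\<close> cover the line and overlap in
  \<open>x\<close>; the inequality is strict exactly when there is an atom at
  \<open>x\<close>.\<close>

lemma symmetric_df_ge_one: "1 \<le> F x + F (- x)"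
proof -
  have "1 = prob ({..x} \<union> {x..})"
    by (subst prob_space[symmetric]) (auto intro!: arg_cong[where f = prob])
  also have "\<dots> \<le> prob {..x} + prob {x..}"
    by (rule measure_Un_le) auto
  finally show ?thesis by (simp add: symmetric_df_atMost symmetric_df_atLeast)
qed

lemma symmetric_df_neg:
  assumes "x < 0"
  shows "2 * F x \<le> 1"
proof -
  have "prob {..x} + prob {- x..} = prob ({..x} \<union> {- x..})"
    using assms by (intro measure_Union[symmetric]) auto
  also have "\<dots> \<le> 1" by simp
  finally show ?thesis by (simp add: symmetric_df_atMost symmetric_df_atLeast)
qed

text \<open>For \<open>0 \<le> x\<close> the half-lines \<open>{..x}\<close> and
  \<open>{- x..}\<close> both have mass \<open>F x\<close>, cover the line and meet in
  \<open>{- x..x}\<close>, so inclusion-exclusion applies.\<close>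

lemma abs_df_eq: "abs_df F x = (if x < 0 then 0 else 2 * F x - 1)"
proof -
  have *: "abs_df F x = prob {- x..x}"
    unfolding abs_df_def cdf_def
    by (subst measure_distr) (auto simp: vimage_def abs_le_iff intro!: arg_cong[where f = prob])
  have "F x + F x = 1 + prob {- x..x}" if "0 \<le> x"
  proof -
    have "prob ({..x} \<union> {- x..}) = prob {..x} + prob {- x..} - prob ({..x} \<inter> {- x..})"
      by (rule measure_Un3) (auto simp: fmeasurable_eq_sets)
    moreover have "{..x} \<union> {- x..} = space (interval_measure F)" "{..x} \<inter> {- x..} = {- x..x}"
      using that by auto
    ultimately show ?thesis
      by (simp add: symmetric_df_atMost symmetric_df_atLeast prob_space del: space_interval_measure space_eq_univ)
  qed
  with * show ?thesis by auto
qed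

lemma is_df_abs_df: "is_df (abs_df F)"
  unfolding abs_df_def by (rule is_df_cdf) simp

text \<open>The sets under the two infima coincide. No negative \<open>x\<close> belongs to either,
  since there \<open>2 * F x \<le> 1 < 1 + w\<close>.\<close>

lemma quantile_abs_df:
  assumes w: "0 < w" "w < 1"
  shows "quantile (abs_df F) w = quantile F ((1 + w) / 2)"
proof -
  have "w \<le> abs_df F x \<longleftrightarrow> (1 + w) / 2 \<le> F x" for x
    using symmetric_df_neg[of x] w by (auto simp: abs_df_eq)
  then show ?thesis by (simp add: quantile_def)
qed

lemma quantile_nonneg:
  assumes u: "1/2 < u" "u < 1"
  shows "0 \<le> quantile F u"
proof (rule ccontr)
  assume "\<not> 0 \<le> quantile F u"
  then show False
    using symmetric_df_neg[of "quantile F u"] quantile_le_iff[OF F, of u "quantile F u"] u by simp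
qed

lemma quantile_nonpos:
  assumes u: "0 < u" "u \<le> 1/2"
  shows "quantile F u \<le> 0"
  using symmetric_df_ge_one[of 0] u by (simp add: quantile_le_iff[OF F])

lemma quantile_reflect_le:
  assumes u: "0 < u" "u < 1"
  shows "quantile F u + quantile F (1 - u) \<le> 0"
proof (rule ccontr)
  assume "\<not> ?thesis"
  \<comment> \<open>Such an \<open>a\<close> lies below \<open>quantile F u\<close>, and
    \<open>- a\<close> lies below \<open>quantile F (1 - u)\<close>. Hence
    \<open>F a + F (- a) < 1\<close>, against the covering by half-lines.\<close>
  then obtain a where a: "a < quantile F u" "- a < quantile F (1 - u)"
    using dense[of "- quantile F (1 - u)" "quantile F u"] by auto
  then have "F a < u" "F (- a) < 1 - u"
    using quantile_le_iff[OF F, of u a] quantile_le_iff[OF F, of "1 - u" "- a"] u by auto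
  then show False using symmetric_df_ge_one[of a] by simp
qed

text \<open>The left-continuous inverse satisfies \<open>quantile F u + quantile F (1 - u) \<le> 0\<close> everywhere,
  with strict inequality possible at jumps; as both terms have mean zero, the sum vanishes
  almost everywhere.\<close>

lemma AE_quantile_reflect:
  assumes mean: "zero_mean_df F"
  shows "AE u in unif. quantile F (1 - u) = - quantile F u"
proof -
  interpret U: prob_space unif by (rule prob_space_unif)
  \<comment> \<open>Stated for general \<open>f\<close> because it is applied to the identity and to
    the reflection; both give a variable with law \<open>F\<close>, hence with mean zero.\<close>
  have int: "has_bochner_integral unif (\<lambda>u. quantile F (f u)) 0" if f: "uniform01 unif f" for f
  proof -
    note h = has_df_quantile[OF F f]
    have [measurable]: "(\<lambda>u. quantile F (f u)) \<in> borel_measurable unif"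
      using h by (simp add: has_df_def)
    have "has_bochner_integral (distr unif borel (\<lambda>u. quantile F (f u))) (\<lambda>x. x) 0"
      using mean by (simp add: has_df_law[OF prob_space_unif h F] zero_mean_df_def)
    then show ?thesis
      by (simp add: has_bochner_integral_iff integrable_distr_eq integral_distr)
  qed
  have i: "has_bochner_integral unif (\<lambda>u. - (quantile F u + quantile F (1 - u))) (- (0 + 0))"
    by (intro has_bochner_integral_minus has_bochner_integral_add int
      uniform01_unif_self uniform01_reflect)
  have "AE u in unif. 0 \<le> - (quantile F u + quantile F (1 - u))"
    using AE_unif by eventually_elim (use quantile_reflect_le in force)
  then have "AE u in unif. - (quantile F u + quantile F (1 - u)) = 0"
    using integral_nonneg_eq_0_iff_AE[OF integrable.intros[OF i]]
      has_bochner_integral_integral_eq[OF i] by simp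
  then show ?thesis by eventually_elim simp
qed

text \<open>On the upper half, \<open>w = 2 * u - 1\<close> gives \<open>(1 + w) / 2 = u\<close>. On
  the lower half it gives \<open>1 - u\<close>, and the almost sure reflection leads back to
  \<open>u\<close>.\<close>

lemma AE_abs_quantile:
  assumes mean: "zero_mean_df F"
  shows "AE u in unif. \<bar>quantile F u\<bar> = quantile (abs_df F) \<bar>2 * u - 1\<bar>"
  using AE_quantile_reflect[OF mean] AE_unif
proof eventually_elim
  case (elim u)
  show ?case
  proof (cases "u > 1/2")
    case True
    then show ?thesis using elim quantile_nonneg[of u] by (simp add: quantile_abs_df)
  next
    case False
    have half: "(1 + (1 - 2 * u)) / 2 = 1 - u" by simp
    have "quantile (abs_df F) (1 - 2 * u) = quantile F (1 - u)"
      by (subst quantile_abs_df) (use False elim in \<open>auto simp only: half\<close>)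
    then show ?thesis
      using False elim quantile_nonpos[of u] by simp
  qed
qed

end

section \<open>Rearrangement over the whole sample space\<close>

lemma nn_integral_uniform01:
  assumes U: "uniform01 M U" and [measurable]: "f \<in> borel_measurable borel"
  shows "(\<integral>\<^sup>+\<omega>. f (U \<omega>) \<partial>M) = (\<integral>\<^sup>+u. f u \<partial>unif)"
proof -
  have [measurable]: "U \<in> borel_measurable M" by (rule uniform01_measurable[OF U])
  have "(\<integral>\<^sup>+\<omega>. f (U \<omega>) \<partial>M) = (\<integral>\<^sup>+u. f u \<partial>distr M borel U)"
    by (simp add: nn_integral_distr)
  then show ?thesis using U by (simp add: uniform01_def)
qed

lemma rearrangement_inequality:
  fixes Y :: "'i \<Rightarrow> 'w \<Rightarrow> real"
  assumes M: "prob_space M" and I: "finite I"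
    and Y: "\<And>i. i \<in> I \<Longrightarrow> Y i \<in> borel_measurable M"
    and nn: "\<And>i \<omega>. i \<in> I \<Longrightarrow> 0 \<le> Y i \<omega>"
  shows "(\<integral>\<^sup>+\<omega>. (\<Prod>i\<in>I. ennreal (Y i \<omega>)) \<partial>M) \<le>
    (\<integral>\<^sup>+u. (\<Prod>i\<in>I. ennreal (quantile (cdf (distr M borel (Y i))) u)) \<partial>unif)"
proof -
  interpret prob_space M by (rule M)
  let ?Q = "\<lambda>u. \<Prod>i\<in>I. ennreal (quantile (cdf (distr M borel (Y i))) u)"
  have "is_df (cdf (distr M borel (Y i)))" if "i \<in> I" for i
    using Y[OF that] by (intro is_df_cdf) simp
  then have [measurable]: "?Q \<in> borel_measurable borel"
    using borel_measurable_quantile by measurable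
  have "(\<integral>\<^sup>+\<omega>. (\<Prod>i\<in>I. ennreal (Y i \<omega>)) \<partial>M)
      = (\<integral>\<^sup>+\<omega>. (\<Prod>i\<in>I. ennreal (Y i \<omega>)) * indicator (space M) \<omega> \<partial>M)"
    by (intro nn_integral_cong) simp
  also have "\<dots> \<le> (\<integral>\<^sup>+u. ?Q u * indicator {1 - prob (space M)<..<1} u \<partial>lborel)"
    by (rule rearrangement_on_set) (use assms in auto)
  also have "\<dots> \<le> (\<integral>\<^sup>+u. ?Q u * indicator {0..1} u \<partial>lborel)"
    by (intro nn_integral_mono) (auto simp: prob_space split: split_indicator)
  also have "\<dots> = (\<integral>\<^sup>+u. ?Q u \<partial>unif)"
    by (subst nn_integral_uniform_measure) (auto simp: divide_ennreal_def)
  finally show ?thesis .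
qed

lemma sgn_prod_real: "sgn (\<Prod>i\<in>I. f i) = (\<Prod>i\<in>I. sgn (f i :: real))"
  by (induction I rule: infinite_finite_induct) (auto simp: sgn_mult)

section \<open>Lower bound for the expected product\<close>

locale symmetric_margins =
  fixes d :: nat and F :: "nat \<Rightarrow> real \<Rightarrow> real"
  assumes d: "2 \<le> d"
    and df: "\<And>i. i \<in> {1..d} \<Longrightarrow> is_df (F i)"
    and mean: "\<And>i. i \<in> {1..d} \<Longrightarrow> zero_mean_df (F i)"
    and sym: "\<And>i. i \<in> {1..d} \<Longrightarrow> symmetric_df (F i)"
begin

text \<open>An extended value, since a product of three or more square integrable factors can have
  infinite expectation.\<close>

definition comonotone_value :: ennreal where
  "comonotone_value = (\<integral>\<^sup>+u. (\<Prod>i=1..d. ennreal (quantile (abs_df (F i)) u)) \<partial>unif)"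

lemma measurable_quantile_abs_df [measurable]:
  "i \<in> {1..d} \<Longrightarrow> quantile (abs_df (F i)) \<in> borel_measurable borel"
  by (intro borel_measurable_quantile is_df_abs_df df sym)

lemma cdf_abs:
  assumes "prob_space M" "has_df M X (F i)" "i \<in> {1..d}"
  shows "cdf (distr M borel (\<lambda>\<omega>. \<bar>X \<omega>\<bar>)) = abs_df (F i)"
proof -
  have [measurable]: "X \<in> borel_measurable M" using assms(2) by (simp add: has_df_def)
  have "distr M borel (\<lambda>\<omega>. \<bar>X \<omega>\<bar>) = distr (distr M borel X) borel abs"
    by (simp add: distr_distr comp_def)
  then show ?thesis
    by (simp add: has_df_law[OF assms(1,2) df[OF assms(3)]] abs_df_def)
qed

lemma neg_part_le:
  assumes X: "random_vector M d F X"
  shows "(\<integral>\<^sup>+\<omega>. ennreal (- (\<Prod>i=1..d. X i \<omega>)) \<partial>M) \<le> comonotone_value"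
proof -
  have M: "prob_space M" and h: "\<And>i. i \<in> {1..d} \<Longrightarrow> has_df M (X i) (F i)"
    using X by (auto simp: random_vector_def)
  have "(\<integral>\<^sup>+\<omega>. ennreal (- (\<Prod>i=1..d. X i \<omega>)) \<partial>M) \<le> (\<integral>\<^sup>+\<omega>. (\<Prod>i=1..d. ennreal \<bar>X i \<omega>\<bar>) \<partial>M)"
    by (intro nn_integral_mono) (auto simp: prod_ennreal abs_prod[symmetric] intro!: ennreal_leI)
  also have "\<dots> \<le> (\<integral>\<^sup>+u. (\<Prod>i=1..d. ennreal (quantile (cdf (distr M borel (\<lambda>\<omega>. \<bar>X i \<omega>\<bar>))) u)) \<partial>unif)"
    by (rule rearrangement_inequality[OF M]) (use h in \<open>auto simp: has_df_def intro!: borel_measurable_abs\<close>)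
  also have "\<dots> = comonotone_value"
    unfolding comonotone_value_def
    by (intro nn_integral_cong prod.cong refl) (simp add: cdf_abs[OF M h])
  finally show ?thesis .
qed

text \<open>Dropping the positive part leaves minus the negative part. If both parts are infinite,
  \<open>ereal\<close> evaluates the difference to \<open>\<infinity>\<close>, in agreement with the
  bound.\<close>

lemma ext_expectation_ge:
  assumes X: "random_vector M d F X"
  shows "- enn2ereal comonotone_value \<le> ext_expectation M (\<lambda>\<omega>. \<Prod>i=1..d. X i \<omega>)"
proof -
  have "0 + - enn2ereal comonotone_value \<le>
      enn2ereal (\<integral>\<^sup>+\<omega>. ennreal (\<Prod>i=1..d. X i \<omega>) \<partial>M) +
      - enn2ereal (\<integral>\<^sup>+\<omega>. ennreal (- (\<Prod>i=1..d. X i \<omega>)) \<partial>M)"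
    using neg_part_le[OF X] by (intro add_mono) (auto simp: less_eq_ennreal.rep_eq)
  then show ?thesis by (simp add: ext_expectation_def minus_ereal_def)
qed

lemma inf_expected_product_ge: "- enn2ereal comonotone_value \<le> inf_expected_product d F"
  unfolding inf_expected_product_def
  by (rule Inf_greatest) (use ext_expectation_ge in blast)

text \<open>Connects \<open>comonotone_value\<close>, a product taken in \<open>ennreal\<close>,
  with the real product in the theorem. The two agree because the quantiles are nonnegative almost
  everywhere.\<close>

lemma ext_expectation_quantiles:
  assumes U: "uniform01 M U"
  shows "ext_expectation M (\<lambda>\<omega>. \<Prod>i=1..d. quantile (abs_df (F i)) (U \<omega>)) = enn2ereal comonotone_value"
proof -
  let ?q = "\<lambda>u. \<Prod>i=1..d. quantile (abs_df (F i)) u"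
  have ae: "AE u in unif. \<forall>i\<in>{1..d}. 0 \<le> quantile (abs_df (F i)) u"
    using AE_unif
  proof eventually_elim
    case (elim u)
    \<comment> \<open>The point \<open>(1 + u) / 2\<close> lies in the upper half of the unit
      interval, where \<open>quantile (F i)\<close> is nonnegative.\<close>
    have "quantile (abs_df (F i)) u = quantile (F i) ((1 + u) / 2)"
      "0 \<le> quantile (F i) ((1 + u) / 2)" if "i \<in> {1..d}" for i
      using elim by (auto intro!: quantile_abs_df quantile_nonneg[OF df[OF that] sym[OF that]] df sym that)
    then show ?case by simp
  qed
  have [measurable]: "?q \<in> borel_measurable borel" by measurable
  have "(\<integral>\<^sup>+\<omega>. ennreal (?q (U \<omega>)) \<partial>M) = (\<integral>\<^sup>+u. ennreal (?q u) \<partial>unif)"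
    by (rule nn_integral_uniform01[OF U]) simp
  also have "\<dots> = comonotone_value"
    unfolding comonotone_value_def
    by (rule nn_integral_cong_AE, use ae in eventually_elim) (subst prod_ennreal, auto)
  finally have pos: "(\<integral>\<^sup>+\<omega>. ennreal (?q (U \<omega>)) \<partial>M) = comonotone_value" .
  have "(\<integral>\<^sup>+\<omega>. ennreal (- ?q (U \<omega>)) \<partial>M) = (\<integral>\<^sup>+u. ennreal (- ?q u) \<partial>unif)"
    by (rule nn_integral_uniform01[OF U]) simp
  also have "\<dots> = (\<integral>\<^sup>+u. 0 \<partial>unif)"
    by (rule nn_integral_cong_AE, use ae in eventually_elim) (auto intro!: ennreal_neg prod_nonneg)
  finally have neg: "(\<integral>\<^sup>+\<omega>. ennreal (- ?q (U \<omega>)) \<partial>M) = 0" by simp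
  show ?thesis unfolding ext_expectation_def pos neg by (simp add: zero_ennreal.rep_eq)
qed

section \<open>Couplings by uniform variables with a common fold\<close>

context
  fixes M :: "'w measure" and T :: "nat \<Rightarrow> 'w \<Rightarrow> real" and W :: "'w \<Rightarrow> real"
  assumes M: "prob_space M"
    and T: "\<And>i. i \<in> {1..d} \<Longrightarrow> uniform01 M (T i)"
    and W: "\<And>i \<omega>. i \<in> {1..d} \<Longrightarrow> \<bar>2 * T i \<omega> - 1\<bar> = W \<omega>"
    and neg: "AE \<omega> in M. (\<Prod>i=1..d. T i \<omega> - 1/2) < 0"
begin

lemma coupling_random_vector: "random_vector M d F (\<lambda>i \<omega>. quantile (F i) (T i \<omega>))"
  using M T df by (auto simp: random_vector_def intro!: has_df_quantile)

text \<open>By assumption \<open>W\<close>, at each sample point all \<open>T i\<close> are equally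
  far from 1/2, so \<open>W\<close> is the fold of any one of them; the index 1 is a convenient
  choice.\<close>

lemma coupling_uniform01: "uniform01 M W"
proof -
  have "1 \<in> {1..d}" using d by simp
  from uniform01_compose[OF T[OF this] uniform01_fold] show ?thesis
    by (simp only: W[OF \<open>1 \<in> {1..d}\<close>])
qed

lemma coupling_abs:
  "AE \<omega> in M. \<forall>i\<in>{1..d}. \<bar>quantile (F i) (T i \<omega>)\<bar> = quantile (abs_df (F i)) (W \<omega>)"
proof (rule AE_ball_countable')
  fix i assume i: "i \<in> {1..d}"
  show "AE \<omega> in M. \<bar>quantile (F i) (T i \<omega>)\<bar> = quantile (abs_df (F i)) (W \<omega>)"
    using uniform01_AE[OF T[OF i] AE_abs_quantile[OF df[OF i] sym[OF i] mean[OF i]]]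
    by (simp add: W[OF i])
qed simp

text \<open>Almost surely the absolute values are the quantiles of the single variable
  \<open>W\<close>, and the law of \<open>W\<close> is \<open>unif\<close>.\<close>

lemma coupling_comonotonic: "comonotonic M d (\<lambda>i \<omega>. \<bar>quantile (F i) (T i \<omega>)\<bar>)"
proof -
  let ?P = "\<Pi>\<^sub>M i\<in>{1..d}. (borel :: real measure)"
  let ?X = "\<lambda>i \<omega>. \<bar>quantile (F i) (T i \<omega>)\<bar>"
  let ?q = "\<lambda>w. \<lambda>i\<in>{1..d}. quantile (abs_df (F i)) w"
  note h = coupling_random_vector[unfolded random_vector_def]
  have [measurable]: "W \<in> borel_measurable M"
    by (rule uniform01_measurable[OF coupling_uniform01])
  have X: "?X i \<in> borel_measurable M" if "i \<in> {1..d}" for i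
    using h that by (intro borel_measurable_abs) (auto simp: has_df_def)
  have G: "cdf (distr M borel (?X i)) = abs_df (F i)" if "i \<in> {1..d}" for i
    by (rule cdf_abs) (use h that in auto)
  have q[measurable]: "?q \<in> measurable borel ?P" by measurable
  have "distr M ?P (\<lambda>\<omega>. \<lambda>i\<in>{1..d}. ?X i \<omega>) = distr M ?P (\<lambda>\<omega>. ?q (W \<omega>))"
  proof (rule distr_cong_AE)
    show "AE \<omega> in M. (\<lambda>i\<in>{1..d}. ?X i \<omega>) = ?q (W \<omega>)"
      using coupling_abs by eventually_elim (auto intro!: restrict_ext)
    show "(\<lambda>\<omega>. \<lambda>i\<in>{1..d}. ?X i \<omega>) \<in> measurable M ?P"
      by (rule measurable_restrict) (use X in auto)
  qed simp_all
  also have "\<dots> = distr (distr M borel W) ?P ?q"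
    by (simp add: distr_distr comp_def)
  also have "\<dots> = distr unif ?P ?q"
    using coupling_uniform01 by (simp add: uniform01_def)
  also have "?q = (\<lambda>w. \<lambda>i\<in>{1..d}. quantile (cdf (distr M borel (?X i))) w)"
    using G by (intro ext restrict_ext) simp
  finally show ?thesis using X unfolding comonotonic_def by blast
qed

lemma coupling_prod_nonpos: "AE \<omega> in M. (\<Prod>i=1..d. quantile (F i) (T i \<omega>)) \<le> 0"
proof -
  have "AE \<omega> in M. \<forall>i\<in>{1..d}. 0 < T i \<omega> \<and> T i \<omega> < 1 \<and> T i \<omega> \<noteq> 1/2"
    by (rule AE_ball_countable'[OF uniform01_AE[OF T AE_unif]]) auto
  with neg show ?thesis
  proof eventually_elim
    case (elim \<omega>)
    \<comment> \<open>A quantile may vanish away from 1/2, so its own sign is not determined; sign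
      of \<open>T i \<omega> - 1/2\<close> times absolute value covers that case too.\<close>
    have "quantile (F i) (T i \<omega>) = sgn (T i \<omega> - 1/2) * \<bar>quantile (F i) (T i \<omega>)\<bar>"
      if i: "i \<in> {1..d}" for i
      using elim i quantile_nonneg[OF df[OF i] sym[OF i], of "T i \<omega>"]
        quantile_nonpos[OF df[OF i] sym[OF i], of "T i \<omega>"]
      by (cases "T i \<omega> > 1/2") (auto simp: sgn_if)
    then have "(\<Prod>i=1..d. quantile (F i) (T i \<omega>))
      = (\<Prod>i=1..d. sgn (T i \<omega> - 1/2) * \<bar>quantile (F i) (T i \<omega>)\<bar>)"
      by (intro prod.cong) auto
    also have "\<dots> = sgn (\<Prod>i=1..d. T i \<omega> - 1/2) * (\<Prod>i=1..d. \<bar>quantile (F i) (T i \<omega>)\<bar>)"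
      by (simp add: prod.distrib sgn_prod_real)
    also have "\<dots> = - (\<Prod>i=1..d. \<bar>quantile (F i) (T i \<omega>)\<bar>)"
      using elim by simp
    finally show ?case by (simp add: prod_nonneg)
  qed
qed

text \<open>The positive part vanishes, so the expectation is well defined even if infinite, and the
  negative part is the full product of absolute values.\<close>

lemma coupling_expectation:
  "expectation_defined M (\<lambda>\<omega>. \<Prod>i=1..d. quantile (F i) (T i \<omega>))"
  "ext_expectation M (\<lambda>\<omega>. \<Prod>i=1..d. quantile (F i) (T i \<omega>)) = - enn2ereal comonotone_value"
proof -
  let ?p = "\<lambda>\<omega>. \<Prod>i=1..d. quantile (F i) (T i \<omega>)"
  have "?p \<in> borel_measurable M"
    using coupling_random_vector
    by (intro borel_measurable_prod) (auto simp: random_vector_def has_df_def)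
  moreover have pos: "(\<integral>\<^sup>+\<omega>. ennreal (?p \<omega>) \<partial>M) = 0"
  proof -
    have "(\<integral>\<^sup>+\<omega>. ennreal (?p \<omega>) \<partial>M) = (\<integral>\<^sup>+\<omega>. 0 \<partial>M)"
      by (rule nn_integral_cong_AE, use coupling_prod_nonpos in eventually_elim) (simp add: ennreal_neg)
    then show ?thesis by simp
  qed
  ultimately show "expectation_defined M ?p" by (simp add: expectation_defined_def)
  have "(\<integral>\<^sup>+\<omega>. ennreal (- ?p \<omega>) \<partial>M) =
      (\<integral>\<^sup>+\<omega>. (\<Prod>i=1..d. ennreal (quantile (abs_df (F i)) (W \<omega>))) \<partial>M)"
  proof (rule nn_integral_cong_AE, use coupling_prod_nonpos coupling_abs in eventually_elim)
    fix \<omega> assume *: "?p \<omega> \<le> 0"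
      "\<forall>i\<in>{1..d}. \<bar>quantile (F i) (T i \<omega>)\<bar> = quantile (abs_df (F i)) (W \<omega>)"
    have "- ?p \<omega> = \<bar>?p \<omega>\<bar>" using *(1) by simp
    also have "\<dots> = (\<Prod>i=1..d. \<bar>quantile (F i) (T i \<omega>)\<bar>)" by (rule abs_prod)
    finally have "ennreal (- ?p \<omega>) = (\<Prod>i=1..d. ennreal \<bar>quantile (F i) (T i \<omega>)\<bar>)"
      by (simp add: prod_ennreal)
    then show "ennreal (- ?p \<omega>) = (\<Prod>i=1..d. ennreal (quantile (abs_df (F i)) (W \<omega>)))"
      using *(2) by simp
  qed
  also have "\<dots> = comonotone_value"
    unfolding comonotone_value_def by (rule nn_integral_uniform01[OF coupling_uniform01]) measurable
  finally show "ext_expectation M ?p = - enn2ereal comonotone_value"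
    unfolding ext_expectation_def pos by (simp add: zero_ennreal.rep_eq)
qed

lemma coupling_inf_expected_product: "inf_expected_product d F = - enn2ereal comonotone_value"
  using inf_expected_product_le[OF coupling_random_vector coupling_expectation(1)]
    inf_expected_product_ge coupling_expectation(2) by simp

lemma coupling_attains_inf: "attains_inf M d F (\<lambda>i \<omega>. quantile (F i) (T i \<omega>))"
  unfolding attains_inf_def coupling_inf_expected_product by (simp only: coupling_expectation simp_thms)

lemmas coupling =
  coupling_random_vector coupling_comonotonic coupling_prod_nonpos coupling_attains_inf

end

end

section \<open>The odd and even choices of uniform variables\<close>

lemma uniform01_mixture:
  assumes M: "prob_space M" and U: "uniform01 M U" and V: "uniform01 M V"
    and ind: "prob_space.indep_var M borel U borel V"
    and [measurable]: "g \<in> borel_measurable borel" "h \<in> borel_measurable borel"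
    and gh: "\<And>u. g u = u \<and> h u = 1 - u \<or> g u = 1 - u \<and> h u = u"
  shows "uniform01 M (\<lambda>\<omega>. if 1/2 < V \<omega> then g (U \<omega>) else h (U \<omega>))"
proof -
  interpret prob_space M by (rule M)
  interpret U: prob_space unif by (rule prob_space_unif)
  note [measurable] = uniform01_measurable[OF U] uniform01_measurable[OF V]
  let ?T = "\<lambda>\<omega>. if 1/2 < V \<omega> then g (U \<omega>) else h (U \<omega>)"
  have law: "prob {\<omega>\<in>space M. X \<omega> \<in> A} = measure unif A"
    if X: "uniform01 M X" and A: "A \<in> sets borel" for X and A :: "real set"
  proof -
    have "measure unif A = measure (distr M borel X) A" using X by (simp add: uniform01_def)
    also have "\<dots> = prob {\<omega>\<in>space M. X \<omega> \<in> A}"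
      using uniform01_measurable[OF X] A by (simp add: measure_distr vimage_def Int_def conj_commute)
    finally show ?thesis by simp
  qed
  have half: "prob {\<omega>\<in>space M. V \<omega> \<in> {1/2<..}} = 1/2" "prob {\<omega>\<in>space M. V \<omega> \<in> {..1/2}} = 1/2"
  proof -
    have "{0..1} \<inter> {1/2<..} = {1/2<..1::real}" "{0..1} \<inter> {..1/2} = {0..1/2::real}" by auto
    then show "prob {\<omega>\<in>space M. V \<omega> \<in> {1/2<..}} = 1/2" "prob {\<omega>\<in>space M. V \<omega> \<in> {..1/2}} = 1/2"
      by (simp_all add: law[OF V] del: mem_Collect_eq greaterThan_iff atMost_iff)
  qed
  have indep: "prob {\<omega>\<in>space M. U \<omega> \<in> A \<and> V \<omega> \<in> B} =
      prob {\<omega>\<in>space M. U \<omega> \<in> A} * prob {\<omega>\<in>space M. V \<omega> \<in> B}"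
    if "A \<in> sets borel" "B \<in> sets borel" for A B
    using indep_varD[OF ind that] by (simp add: vimage_def Int_def conj_commute)
  have "emeasure (distr M borel ?T) A = emeasure unif A" if A: "A \<in> sets borel" for A
  proof -
    note [measurable] = A
    have "prob {\<omega>\<in>space M. ?T \<omega> \<in> A} =
        prob ({\<omega>\<in>space M. U \<omega> \<in> g -` A \<and> V \<omega> \<in> {1/2<..}} \<union> {\<omega>\<in>space M. U \<omega> \<in> h -` A \<and> V \<omega> \<in> {..1/2}})"
      by (intro arg_cong[where f = prob]) auto
    also have "\<dots> = prob {\<omega>\<in>space M. U \<omega> \<in> g -` A \<and> V \<omega> \<in> {1/2<..}} +
        prob {\<omega>\<in>space M. U \<omega> \<in> h -` A \<and> V \<omega> \<in> {..1/2}}"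
      by (rule measure_Union) auto
    \<comment> \<open>Independence of \<open>V\<close> makes the law of \<open>?T\<close> the
      average of the images of \<open>unif\<close> under \<open>g\<close> and
      \<open>h\<close>.\<close>
    also have "\<dots> = (measure unif (g -` A) + measure unif (h -` A)) / 2"
    proof -
      have "g -` A \<in> sets borel" "h -` A \<in> sets borel"
        using measurable_sets[of g borel borel A] measurable_sets[of h borel borel A] by auto
      then show ?thesis
        by (subst (1 2) indep)
           (simp_all only: half law[OF U] borel_open borel_closed open_greaterThan closed_atMost, argo)
    qed
    \<comment> \<open>Neither image has to be uniform. But \<open>g u\<close> and \<open>h u\<close>
      are \<open>u\<close> and \<open>1 - u\<close> in some order, so the sum of the two indicators
      is the same as for the identity and the reflection.\<close>
    also have "measure unif (g -` A) + measure unif (h -` A) = measure unif A + measure unif ((\<lambda>u. 1 - u) -` A)"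
    proof -
      have m: "measure unif (f -` A) = (\<integral>u. indicator A (f u) \<partial>unif)"
        and i: "integrable unif (\<lambda>u. indicator A (f u) :: real)"
        if [measurable]: "f \<in> borel_measurable borel" for f :: "real \<Rightarrow> real"
      proof -
        have "f -` A \<in> sets borel" using measurable_sets[of f borel borel A] by auto
        then show "measure unif (f -` A) = (\<integral>u. indicator A (f u) \<partial>unif)"
          by (simp add: indicator_vimage[symmetric] comp_def)
        show "integrable unif (\<lambda>u. indicator A (f u) :: real)"
          by (rule U.integrable_const_bound[where B = 1]) auto
      qed
      have "measure unif (g -` A) + measure unif (h -` A) = (\<integral>u. indicator A (g u) + indicator A (h u) \<partial>unif)"
        by (simp add: m i)
      also have "\<dots> = (\<integral>u. indicator A u + indicator A (1 - u) \<partial>unif)"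
      proof (rule Bochner_Integration.integral_cong[OF refl])
        fix u show "indicator A (g u) + indicator A (h u) = (indicator A u + indicator A (1 - u) :: real)"
          using gh[of u] by auto
      qed
      also have "\<dots> = measure unif ((\<lambda>u. u) -` A) + measure unif ((\<lambda>u. 1 - u) -` A)"
        by (simp only: m i Bochner_Integration.integral_add borel_measurable_diff borel_measurable_const measurable_ident_sets[OF refl])
      finally show ?thesis by simp
    qed
    also have "measure unif ((\<lambda>u. 1 - u) -` A) = measure unif A"
    proof -
      have "measure unif A = measure (distr unif borel (\<lambda>u. 1 - u)) A"
        using uniform01_reflect by (simp add: uniform01_def)
      then show ?thesis by (simp add: measure_distr)
    qed
    finally have *: "prob {\<omega>\<in>space M. ?T \<omega> \<in> A} = measure unif A" by simp
    have "measure (distr M borel ?T) A = prob {\<omega>\<in>space M. ?T \<omega> \<in> A}"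
      by (simp add: measure_distr vimage_def Int_def conj_commute)
    with * have "measure (distr M borel ?T) A = measure unif A" by simp
    moreover interpret T: prob_space "distr M borel ?T" by (rule prob_space_distr) simp
    show ?thesis unfolding T.emeasure_eq_measure U.emeasure_eq_measure by (simp only: calculation)
  qed
  then have "distr M borel ?T = unif" by (intro measure_eqI) simp_all
  then show ?thesis by (simp add: uniform01_def)
qed

text \<open>Read as cases, \<open>V\<close> decides whether the last but one variable is reflected,
  and whether the last one is the smaller or the larger of \<open>U\<close> and
  \<open>1 - U\<close>.\<close>

lemma odd_uniforms_eq:
  "odd_uniforms d U V i \<omega> =
    (if i = d then if 1/2 < V \<omega> then if 1/2 < U \<omega> then 1 - U \<omega> else U \<omega> else if 1/2 < U \<omega> then U \<omega> else 1 - U \<omega>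
     else if i = d - 1 then if 1/2 < V \<omega> then U \<omega> else 1 - U \<omega>
     else U \<omega>)"
  by (simp add: odd_uniforms_def)

lemma uniform01_odd_uniforms:
  assumes "prob_space M" "uniform01 M U" "uniform01 M V" "prob_space.indep_var M borel U borel V"
  shows "uniform01 M (odd_uniforms d U V i)"
proof -
  consider "i = d" | "i \<noteq> d" "i = d - 1" | "i \<noteq> d" "i \<noteq> d - 1" by blast
  then show ?thesis
  proof cases
    case 1
    \<comment> \<open>The branches are the minimum and the maximum of \<open>u\<close> and
      \<open>1 - u\<close>; only their fair mixture is uniform.\<close>
    then show ?thesis
      using uniform01_mixture[OF assms, of "\<lambda>u. if 1/2 < u then 1 - u else u" "\<lambda>u. if 1/2 < u then u else 1 - u"]
      by (simp add: odd_uniforms_eq[abs_def])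
  next
    case 2
    then show ?thesis
      using uniform01_mixture[OF assms, of "\<lambda>u. u" "\<lambda>u. 1 - u"]
      by (simp add: odd_uniforms_eq[abs_def])
  next
    case 3
    then show ?thesis using assms(2) by (simp add: odd_uniforms_eq[abs_def])
  qed
qed

lemma abs_odd_uniforms: "\<bar>2 * odd_uniforms d U V i \<omega> - 1\<bar> = \<bar>2 * U \<omega> - 1\<bar>"
  by (auto simp: odd_uniforms_eq)

text \<open>With \<open>c = U \<omega> - 1/2\<close>, the last two factors multiply to
  \<open>- c * c\<close> if \<open>0 < c\<close> and to \<open>c * c\<close> if
  \<open>c < 0\<close>, whatever \<open>V\<close> is. The other \<open>d - 2\<close> factors equal
  \<open>c\<close>, and their number is odd.\<close>

lemma prod_odd_uniforms:
  assumes d: "odd d" "2 \<le> d" and u: "U \<omega> \<noteq> 1/2"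
  shows "(\<Prod>i=1..d. odd_uniforms d U V i \<omega> - 1/2) < 0"
proof -
  obtain k where k: "d = Suc (Suc k)" using d(2) by (metis Suc_le_D numeral_2_eq_2 Suc_le_mono)
  define c where "c = U \<omega> - 1/2"
  have "(\<Prod>i=1..k. odd_uniforms d U V i \<omega> - 1/2) = (\<Prod>i=1..k. c)"
    by (intro prod.cong) (auto simp: odd_uniforms_eq k c_def)
  then have "(\<Prod>i=1..d. odd_uniforms d U V i \<omega> - 1/2) =
    c ^ k * (odd_uniforms d U V (Suc k) \<omega> - 1/2) * (odd_uniforms d U V d \<omega> - 1/2)"
    by (simp add: k prod.cl_ivl_Suc)
  also have "odd_uniforms d U V (Suc k) \<omega> - 1/2 = (if 1/2 < V \<omega> then c else - c)"
    by (simp add: odd_uniforms_eq k c_def)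
  also have "odd_uniforms d U V d \<omega> - 1/2 = (if (1/2 < V \<omega>) = (0 < c) then - c else c)"
    by (auto simp: odd_uniforms_eq c_def)
  also have "c ^ k * (if 1/2 < V \<omega> then c else - c) * (if (1/2 < V \<omega>) = (0 < c) then - c else c) =
      (if 0 < c then - (c ^ k * c * c) else c ^ k * c * c)"
    by simp
  also have "c ^ k * c * c = c ^ d" by (simp add: k)
  also have "(if 0 < c then - (c ^ d) else c ^ d) < 0"
    using d(1) u by (auto simp: c_def power_less_zero_eq)
  finally show ?thesis .
qed

lemma uniform01_even_uniforms:
  assumes "uniform01 M U"
  shows "uniform01 M (even_uniforms d U i)"
  using assms uniform01_compose[OF assms uniform01_reflect]
  by (cases "i = d") (simp_all add: even_uniforms_def[abs_def])

lemma abs_even_uniforms: "\<bar>2 * even_uniforms d U i \<omega> - 1\<bar> = \<bar>2 * U \<omega> - 1\<bar>"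
  by (auto simp: even_uniforms_def)

lemma prod_even_uniforms:
  assumes d: "even d" "2 \<le> d" and u: "U \<omega> \<noteq> 1/2"
  shows "(\<Prod>i=1..d. even_uniforms d U i \<omega> - 1/2) < 0"
proof -
  obtain k where k: "d = Suc k" using d(2) by (cases d) auto
  define c where "c = U \<omega> - 1/2"
  have "(\<Prod>i=1..k. even_uniforms d U i \<omega> - 1/2) = (\<Prod>i=1..k. c)"
    by (intro prod.cong) (auto simp: even_uniforms_def k c_def)
  then have "(\<Prod>i=1..d. even_uniforms d U i \<omega> - 1/2) = c ^ k * (even_uniforms d U d \<omega> - 1/2)"
    by (simp add: k prod.cl_ivl_Suc)
  also have "\<dots> = - (c ^ d)"
    by (simp add: even_uniforms_def k c_def algebra_simps)
  also have "\<dots> < 0" using d(1) u by (simp add: c_def zero_less_power_eq)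
  finally show ?thesis .
qed

text \<open>Supplies the sample space for the existence claim: the coordinates of a product of two
  copies of \<open>unif\<close>.\<close>

lemma ex_indep_uniforms:
  "\<exists>(N :: (nat \<Rightarrow> real) measure) U V. prob_space N \<and> uniform01 N U \<and> uniform01 N V \<and>
     prob_space.indep_var N borel U borel V"
proof -
  let ?N = "\<Pi>\<^sub>M i\<in>{0, 1 :: nat}. unif"
  interpret N: prob_space ?N by (intro prob_space_PiM prob_space_unif)
  have coord: "uniform01 ?N (\<lambda>x. x i)" if i: "i \<in> {0, 1}" for i
  proof -
    have "(\<lambda>x. x i) \<in> measurable ?N unif" by (rule measurable_component_singleton[OF i])
    then have m: "(\<lambda>x. x i) \<in> borel_measurable ?N" by (simp cong: measurable_cong_sets)
    have "distr ?N unif (\<lambda>x. x i) = unif"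
      by (rule distr_PiM_component[OF prob_space_unif i])
    moreover have "distr ?N borel (\<lambda>x. x i) = distr ?N unif (\<lambda>x. x i)"
      by (rule distr_cong) auto
    ultimately show ?thesis using m by (simp add: uniform01_def)
  qed
  have "N.indep_vars (\<lambda>_. borel) (\<lambda>i x. x i) {0, 1}"
  proof (subst N.indep_vars_iff_distr_eq_PiM')
    \<comment> \<open>The joint law of the coordinates is the product measure itself;
      \<open>unif\<close> and \<open>borel\<close> have the same measurable sets.\<close>
    have "distr ?N (\<Pi>\<^sub>M i\<in>{0, 1}. borel) (\<lambda>x. \<lambda>i\<in>{0, 1}. x i) = distr ?N ?N (\<lambda>x. x)"
    proof (rule distr_cong)
      show "sets (\<Pi>\<^sub>M i\<in>{0, 1 :: nat}. (borel :: real measure)) = sets ?N"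
        by (rule sets_PiM_cong) auto
    qed (auto simp: space_PiM PiE_def extensional_restrict)
    also have "\<dots> = (\<Pi>\<^sub>M i\<in>{0, 1}. distr ?N borel (\<lambda>x. x i))"
      by (subst distr_id, rule PiM_cong) (use coord in \<open>auto simp: uniform01_def\<close>)
    finally show "distr ?N (\<Pi>\<^sub>M i\<in>{0, 1}. borel) (\<lambda>x. \<lambda>i\<in>{0, 1}. x i)
      = (\<Pi>\<^sub>M i\<in>{0, 1}. distr ?N borel (\<lambda>x. x i))" .
  qed (use coord uniform01_measurable in auto)
  \<comment> \<open>Independence of the family passes to the blocks \<open>{0}\<close> and
    \<open>{1}\<close>, each then evaluated at its only index.\<close>
  then have "N.indep_var borel ((\<lambda>f. f 0) \<circ> (\<lambda>x. restrict x {0})) borel ((\<lambda>f. f 1) \<circ> (\<lambda>x. restrict x {1}))"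
    by (intro N.indep_var_compose[OF N.indep_var_restrict[where I = "{0, 1}"]] measurable_component_singleton) auto
  then have "N.indep_var borel (\<lambda>x. x 0) borel (\<lambda>x. x 1)"
    by (simp add: comp_def)
  then show ?thesis
    using coord[of 0] coord[of 1] N.prob_space_axioms
    by (intro exI[of _ ?N] exI[of _ "\<lambda>x. x 0"] exI[of _ "\<lambda>x. x 1"]) simp
qed

section \<open>Optimality of the explicit couplings\<close>

context symmetric_margins
begin

lemma odd_coupling:
  assumes "odd d" and M: "prob_space M" and U: "uniform01 M U" and V: "uniform01 M V"
    and ind: "prob_space.indep_var M borel U borel V"
  defines "X \<equiv> \<lambda>i \<omega>. quantile (F i) (odd_uniforms d U V i \<omega>)"
  shows "random_vector M d F X" "comonotonic M d (\<lambda>i \<omega>. \<bar>X i \<omega>\<bar>)"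
    "AE \<omega> in M. (\<Prod>i=1..d. X i \<omega>) \<le> 0" "attains_inf M d F X"
    "inf_expected_product d F = - enn2ereal comonotone_value"
proof -
  have "AE \<omega> in M. (\<Prod>i=1..d. odd_uniforms d U V i \<omega> - 1/2) < 0"
    using uniform01_AE[OF U AE_unif] by eventually_elim (simp only: prod_odd_uniforms[OF assms(1) d] not_False_eq_True simp_thms)
  note * = M uniform01_odd_uniforms[OF M U V ind] abs_odd_uniforms this
  show "random_vector M d F X" "comonotonic M d (\<lambda>i \<omega>. \<bar>X i \<omega>\<bar>)"
    "AE \<omega> in M. (\<Prod>i=1..d. X i \<omega>) \<le> 0" "attains_inf M d F X"
    "inf_expected_product d F = - enn2ereal comonotone_value"
    unfolding X_def by (rule coupling[OF *] coupling_inf_expected_product[OF *])+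
qed

lemma even_coupling:
  assumes "even d" and M: "prob_space M" and U: "uniform01 M U"
  defines "X \<equiv> \<lambda>i \<omega>. quantile (F i) (even_uniforms d U i \<omega>)"
  shows "random_vector M d F X" "comonotonic M d (\<lambda>i \<omega>. \<bar>X i \<omega>\<bar>)"
    "AE \<omega> in M. (\<Prod>i=1..d. X i \<omega>) \<le> 0" "attains_inf M d F X"
    "inf_expected_product d F = - enn2ereal comonotone_value"
proof -
  have "AE \<omega> in M. (\<Prod>i=1..d. even_uniforms d U i \<omega> - 1/2) < 0"
    using uniform01_AE[OF U AE_unif] by eventually_elim (simp only: prod_even_uniforms[OF assms(1) d] not_False_eq_True simp_thms)
  note * = M uniform01_even_uniforms[OF U] abs_even_uniforms this
  show "random_vector M d F X" "comonotonic M d (\<lambda>i \<omega>. \<bar>X i \<omega>\<bar>)"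
    "AE \<omega> in M. (\<Prod>i=1..d. X i \<omega>) \<le> 0" "attains_inf M d F X"
    "inf_expected_product d F = - enn2ereal comonotone_value"
    unfolding X_def by (rule coupling[OF *] coupling_inf_expected_product[OF *])+
qed

text \<open>The infimum is evaluated on this auxiliary space as well: its value does not refer to
  the given sample space, which for odd \<open>d\<close> may carry no uniform \<open>V\<close>
  independent of \<open>U\<close>.\<close>

lemma ex_coupling:
  "(\<exists>(N :: (nat \<Rightarrow> real) measure) X.
      random_vector N d F X \<and> comonotonic N d (\<lambda>i \<omega>. \<bar>X i \<omega>\<bar>) \<and>
      (AE \<omega> in N. (\<Prod>i=1..d. X i \<omega>) \<le> 0) \<and> attains_inf N d F X) \<and>
   inf_expected_product d F = - enn2ereal comonotone_value"
proof -
  obtain N :: "(nat \<Rightarrow> real) measure" and U V where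
    *: "prob_space N" "uniform01 N U" "uniform01 N V" "prob_space.indep_var N borel U borel V"
    using ex_indep_uniforms by blast
  show ?thesis
  proof (cases "odd d")
    case True
    from odd_coupling[OF this *] show ?thesis by (intro conjI exI)
  next
    case False
    then have "even d" by simp
    from even_coupling[OF this *(1,2)] show ?thesis by (intro conjI exI)
  qed
qed

end

theorem theorem3p2:
  fixes d :: nat and F :: "nat \<Rightarrow> real \<Rightarrow> real"
    and M :: "'w measure" and U :: "'w \<Rightarrow> real"
  assumes "d \<ge> 2"
    and "\<And>i. i \<in> {1..d} \<Longrightarrow> is_df (F i)"
    and "\<And>i. i \<in> {1..d} \<Longrightarrow> square_integrable_df (F i)"
    and "\<And>i. i \<in> {1..d} \<Longrightarrow> zero_mean_df (F i)"
    and "\<And>i. i \<in> {1..d} \<Longrightarrow> symmetric_df (F i)"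
    and "prob_space M" and "uniform01 M U"
  shows
    "(\<exists>(N :: (nat \<Rightarrow> real) measure) X.
        random_vector N d F X \<and> comonotonic N d (\<lambda>i \<omega>. \<bar>X i \<omega>\<bar>) \<and>
        (AE \<omega> in N. (\<Prod>i=1..d. X i \<omega>) \<le> 0) \<and> attains_inf N d F X)
     \<and> inf_expected_product d F
         = - ext_expectation M (\<lambda>\<omega>. \<Prod>i=1..d. quantile (abs_df (F i)) (U \<omega>))
     \<and> (odd d \<longrightarrow> (\<forall>V. uniform01 M V \<longrightarrow> prob_space.indep_var M borel U borel V \<longrightarrow>
          (let X = (\<lambda>i \<omega>. quantile (F i) (odd_uniforms d U V i \<omega>)) in
          random_vector M d F X \<and> comonotonic M d (\<lambda>i \<omega>. \<bar>X i \<omega>\<bar>) \<and>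
          (AE \<omega> in M. (\<Prod>i=1..d. X i \<omega>) \<le> 0) \<and> attains_inf M d F X)))
     \<and> (even d \<longrightarrow> (let X = (\<lambda>i \<omega>. quantile (F i) (even_uniforms d U i \<omega>)) in
          random_vector M d F X \<and> comonotonic M d (\<lambda>i \<omega>. \<bar>X i \<omega>\<bar>) \<and>
          (AE \<omega> in M. (\<Prod>i=1..d. X i \<omega>) \<le> 0) \<and> attains_inf M d F X))"
proof -
  interpret symmetric_margins d F
    by (rule symmetric_margins.intro) (fact assms)+
  show ?thesis
    unfolding Let_def ext_expectation_quantiles[OF assms(7)]
    by (intro conjI impI allI ex_coupling[THEN conjunct1] ex_coupling[THEN conjunct2]
      odd_coupling even_coupling assms)
qed

end
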